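(* Let $R(z)$ be given by the stable representation $$R(z)=\delta+z\gamma_+(I_{\mathcal X_+}-z\alpha_+)^{-1}\beta_++\gamma_-(zI_{\mathcal X_-}-\alpha_-)^{-1}\beta_-$$ with $\alpha_-$ and $R(0)=\delta-\gamma_-\alpha_-^{-1}\beta_-$ invertible. If $Q\in\mathcal B(\mathcal X_+,\mathcal X_-)$ solves $$\text{(I)}\quad Q=\alpha_-Q\alpha_++(\beta_--\alpha_-Q\beta_+)(\delta-\gamma_-Q\beta_+)^{-1}(\gamma_+-\gamma_-Q\alpha_+),$$ then the operator $\alpha_+^\circ:=\alpha_+-\beta_+(\delta-\gamma_-Q\beta_+)^{-1}(\gamma_+-\gamma_-Q\alpha_+)$ is also given by $$\alpha_+^\circ=\alpha_+-\beta_+(\delta-\gamma_-\alpha_-^{-1}\beta_-)^{-1}(\gamma_+-\gamma_-\alpha_-^{-1}Q).$$ In this case, the (unique) stabilizing solutions in $\mathrm{Ricc}_1$ and $\mathrm{Ricc}_2'$ coincide; that is, $Q$ is a stabilizing solution in $\mathrm{Ricc}_1$ if and only if it is a stabilizing solution in $\mathrm{Ricc}_2'$, and there is at most one such $Q$.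
   Context: $\mathbb D$ is the open unit disc. $\mathcal B(\mathcal X,\mathcal Y)$ denotes bounded linear operators between Hilbert spaces; "invertible" means boundedly invertible. An operator $T$ is (exponentially) stable if $\sigma(T)\subset\mathbb D$, and anti-stable if $\sigma(T)\subset\mathbb C\setminus\overline{\mathbb D}$. A stable representation of a $\mathcal B(\mathcal U)$-valued function $R$ is a formula as displayed in the claim, where $\mathcal U,\mathcal X_+,\mathcal X_-$ are complex Hilbert spaces, $\delta\in\mathcal B(\mathcal U)$, $\alpha_\pm\in\mathcal B(\mathcal X_\pm)$, $\beta_\pm\in\mathcal B(\mathcal U,\mathcal X_\pm)$, $\gamma_\pm\in\mathcal B(\mathcal X_\pm,\mathcal U)$, and $\alpha_+$, $\alpha_-$ are exponentially stable. A solution of (I) is required to have $\delta-\gamma_-Q\beta_+$ invertible. The second Riccati equation is $$\text{(II)}\quad Q=\alpha_-Q\alpha_++(\beta_--\alpha_-Q\beta_+)(\delta-\gamma_-\alpha_-^{-1}\beta_-)^{-1}(\gamma_+-\gamma_-\alpha_-^{-1}Q).$$ $\mathrm{Ricc}_1$ is the set of $Q\in\mathcal B(\mathcal X_+,\mathcal X_-)$ that solve (I); $\mathrm{Ricc}_2'$ is the set of $Q\in\mathcal B(\mathcal X_+,\mathcal X_-)$ that solve (II) and for which $\delta-\gamma_-Q\beta_+$ is invertible. A solution $Q$ of (I) is stabilizing if both $\alpha_+^\circ=\alpha_+-\beta_+(\delta-\gamma_-Q\beta_+)^{-1}(\gamma_+-\gamma_-Q\alpha_+)$ and $\alpha_-^\circ=\alpha_--(\beta_--\alpha_-Q\beta_+)(\delta-\gamma_-Q\beta_+)^{-1}\gamma_-$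 are exponentially stable. A solution $Q$ of (II) is stabilizing if $\alpha_+-\beta_+(\delta-\gamma_-\alpha_-^{-1}\beta_-)^{-1}(\gamma_+-\gamma_-\alpha_-^{-1}Q)$ is stable and $\alpha_-^{-1}+\alpha_-^{-1}(\beta_--\alpha_-Q\beta_+)(\delta-\gamma_-\alpha_-^{-1}\beta_-)^{-1}\gamma_-\alpha_-^{-1}$ is anti-stable. *)

theory Defs
  imports "HOL-Analysis.Analysis"
begin

class scaleC =
  fixes scaleC :: "complex \<Rightarrow> 'a \<Rightarrow> 'a" (infixr \<open>*\<^sub>C\<close> 75)

text \<open>Complex Hilbert spaces: the real Banach space structure of the library, extended by a
  compatible complex scalar multiplication and a sesquilinear form (linear in the first argument)
  that induces the norm. The last axiom contains positive definiteness.\<close>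

class complex_hilbert = banach + scaleC +
  fixes cinner :: "'a \<Rightarrow> 'a \<Rightarrow> complex"
  assumes scaleC_add_right: "z *\<^sub>C (x + y) = z *\<^sub>C x + z *\<^sub>C y"
    and scaleC_add_left: "(z + w) *\<^sub>C x = z *\<^sub>C x + w *\<^sub>C x"
    and scaleC_scaleC: "z *\<^sub>C w *\<^sub>C x = (z * w) *\<^sub>C x"
    and scaleC_of_real: "complex_of_real r *\<^sub>C x = r *\<^sub>R x"
    and cinner_commute: "cinner x y = cnj (cinner y x)"
    and cinner_add_left: "cinner (x + y) v = cinner x v + cinner y v"
    and cinner_scaleC_left: "cinner (z *\<^sub>C x) y = z * cinner x y"
    and cinner_self: "cinner x x = complex_of_real ((norm x)\<^sup>2)"

instantiation complex :: complex_hilbert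
begin

definition scaleC_complex :: "complex \<Rightarrow> complex \<Rightarrow> complex"
  where "scaleC_complex z x = z * x"

definition cinner_complex :: "complex \<Rightarrow> complex \<Rightarrow> complex"
  where "cinner_complex x y = x * cnj y"

instance
  by standard
    (auto simp: scaleC_complex_def cinner_complex_def algebra_simps scaleR_conv_of_real
      complex_norm_square [symmetric])

end

lemma norm_scaleC: "norm (z *\<^sub>C x) = cmod z * norm (x :: 'a::complex_hilbert)"
proof -
  have "complex_of_real ((norm (z *\<^sub>C x))\<^sup>2) = z * cnj (z * cinner x x)"
    by (metis cinner_commute cinner_scaleC_left cinner_self)
  also have "\<dots> = complex_of_real ((cmod z * norm x)\<^sup>2)"
    using complex_norm_square [of z] by (simp add: cinner_self power_mult_distrib)
  finally have "(norm (z *\<^sub>C x))\<^sup>2 = (cmod z * norm x)\<^sup>2"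
    using of_real_eq_iff by blast
  then show ?thesis
    by simp
qed

lemma scaleC_scaleR_commute: "z *\<^sub>C (r *\<^sub>R x) = r *\<^sub>R (z *\<^sub>C (x :: 'a::complex_hilbert))"
  by (metis scaleC_of_real scaleC_scaleC mult.commute)

lemma bounded_linear_scaleC: "bounded_linear (\<lambda>x :: 'a::complex_hilbert. z *\<^sub>C x)"
  by (rule bounded_linear_intro [where K = "cmod z"])
    (simp_all add: scaleC_add_right scaleC_scaleR_commute norm_scaleC mult.commute)

instantiation blinfun :: (real_normed_vector, complex_hilbert) scaleC
begin

lift_definition scaleC_blinfun :: "complex \<Rightarrow> ('a \<Rightarrow>\<^sub>L 'b) \<Rightarrow> ('a \<Rightarrow>\<^sub>L 'b)"
  is "\<lambda>z T x. z *\<^sub>C T x"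
  by (rule bounded_linear_compose [OF bounded_linear_scaleC])

instance ..

end

text \<open>Operator product, binding more tightly than \<open>+\<close> and \<open>-\<close> (unlike \<open>o\<^sub>L\<close>).\<close>

notation blinfun_compose (infixl \<open>\<odot>\<close> 70)

text \<open>The library type \<^typ>\<open>'a \<Rightarrow>\<^sub>L 'b\<close> consists of the real-linear bounded maps; the space
  \<open>B(X,Y)\<close> of the paper consists of those which are also complex-homogeneous.\<close>

definition complex_op :: "('a::complex_hilbert \<Rightarrow>\<^sub>L 'b::complex_hilbert) \<Rightarrow> bool"
  where "complex_op T \<longleftrightarrow> (\<forall>z x. T (z *\<^sub>C x) = z *\<^sub>C T x)"

definition op_invertible :: "('a::real_normed_vector \<Rightarrow>\<^sub>L 'b::real_normed_vector) \<Rightarrow> bool"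
  where "op_invertible T \<longleftrightarrow> (\<exists>S. S \<odot> T = id_blinfun \<and> T \<odot> S = id_blinfun)"

text \<open>Meaningful only for invertible \<open>T\<close>.\<close>

definition op_inv ::
    "('a::real_normed_vector \<Rightarrow>\<^sub>L 'b::real_normed_vector) \<Rightarrow> ('b \<Rightarrow>\<^sub>L 'a)"
  where "op_inv T = (THE S. S \<odot> T = id_blinfun \<and> T \<odot> S = id_blinfun)"

lemma op_inv:
  assumes "op_invertible T"
  shows "op_inv T \<odot> T = id_blinfun" "T \<odot> op_inv T = id_blinfun"
proof -
  obtain S where S: "S \<odot> T = id_blinfun" "T \<odot> S = id_blinfun"
    using assms by (auto simp: op_invertible_def)
  have "op_inv T = S"
    unfolding op_inv_def
  proof (rule the_equality)
    fix S' assume S': "S' \<odot> T = id_blinfun \<and> T \<odot> S' = id_blinfun"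
    show "S' = S"
    proof (rule blinfun_eqI)
      fix y
      have "S' y = S' (T (S y))"
        using S(2) by (metis blinfun_apply_blinfun_compose id_blinfun.rep_eq)
      also have "\<dots> = S y"
        using S' by (metis blinfun_apply_blinfun_compose id_blinfun.rep_eq)
      finally show "S' y = S y" .
    qed
  qed (use S in simp)
  with S show "op_inv T \<odot> T = id_blinfun" "T \<odot> op_inv T = id_blinfun"
    by simp_all
qed

text \<open>Hence invertibility among real-linear operators agrees with invertibility in \<open>B(X,Y)\<close>.\<close>

lemma complex_op_op_inv:
  assumes "complex_op T" "op_invertible T"
  shows "complex_op (op_inv T)"
  unfolding complex_op_def
proof (intro allI)
  fix z y
  have l: "op_inv T (T x) = x" and r: "T (op_inv T v) = v" for x v
    using op_inv [OF assms(2)] by (metis blinfun_apply_blinfun_compose id_blinfun.rep_eq)+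
  have "op_inv T (z *\<^sub>C y) = op_inv T (T (z *\<^sub>C op_inv T y))"
    using assms(1) by (simp add: complex_op_def r)
  then show "op_inv T (z *\<^sub>C y) = z *\<^sub>C op_inv T y"
    by (simp add: l)
qed

definition op_spectrum :: "('a::complex_hilbert \<Rightarrow>\<^sub>L 'a) \<Rightarrow> complex set"
  where "op_spectrum T = {z. \<not> op_invertible (z *\<^sub>C id_blinfun - T)}"

definition op_stable :: "('a::complex_hilbert \<Rightarrow>\<^sub>L 'a) \<Rightarrow> bool"
  where "op_stable T \<longleftrightarrow> op_spectrum T \<subseteq> ball 0 1"

definition op_antistable :: "('a::complex_hilbert \<Rightarrow>\<^sub>L 'a) \<Rightarrow> bool"
  where "op_antistable T \<longleftrightarrow> op_spectrum T \<subseteq> - cball 0 1"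

text \<open>In the argument lists below, \<open>ap, bp, gp\<close> and \<open>am, bm, gm\<close> stand for
  \<open>\<alpha>\<^sub>+, \<beta>\<^sub>+, \<gamma>\<^sub>+\<close> and \<open>\<alpha>\<^sub>-, \<beta>\<^sub>-, \<gamma>\<^sub>-\<close>. The formula for \<open>R z\<close> is imposed at every \<open>z\<close> where both
  resolvents exist: this includes the unit circle, and \<open>0\<close> if \<open>am\<close> is invertible.\<close>

definition stable_representation ::
    "(complex \<Rightarrow> 'u::complex_hilbert \<Rightarrow>\<^sub>L 'u) \<Rightarrow> ('u \<Rightarrow>\<^sub>L 'u) \<Rightarrow>
     ('p::complex_hilbert \<Rightarrow>\<^sub>L 'p) \<Rightarrow> ('u \<Rightarrow>\<^sub>L 'p) \<Rightarrow> ('p \<Rightarrow>\<^sub>L 'u) \<Rightarrow>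
     ('m::complex_hilbert \<Rightarrow>\<^sub>L 'm) \<Rightarrow> ('u \<Rightarrow>\<^sub>L 'm) \<Rightarrow> ('m \<Rightarrow>\<^sub>L 'u) \<Rightarrow> bool"
  where "stable_representation R \<delta> ap bp gp am bm gm \<longleftrightarrow>
    complex_op \<delta> \<and>
    complex_op ap \<and> complex_op bp \<and> complex_op gp \<and>
    complex_op am \<and> complex_op bm \<and> complex_op gm \<and>
    op_stable ap \<and> op_stable am \<and>
    (\<forall>z. op_invertible (id_blinfun - z *\<^sub>C ap) \<and> op_invertible (z *\<^sub>C id_blinfun - am) \<longrightarrow>
      R z = \<delta> + z *\<^sub>C (gp \<odot> op_inv (id_blinfun - z *\<^sub>C ap) \<odot> bp)
              + gm \<odot> op_inv (z *\<^sub>C id_blinfun - am) \<odot> bm)"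

lemma scaleC_blinfun_zero: "0 *\<^sub>C (T :: 'a::real_normed_vector \<Rightarrow>\<^sub>L 'b::complex_hilbert) = 0"
  using scaleC_of_real [of 0] by (intro blinfun_eqI) (simp add: scaleC_blinfun.rep_eq)

lemma op_invertible_id: "op_invertible id_blinfun"
  unfolding op_invertible_def by (rule exI [of _ id_blinfun]) (auto intro: blinfun_eqI)

lemma op_inv_eqI:
  assumes "S \<odot> T = id_blinfun" "T \<odot> S = id_blinfun"
  shows "op_invertible T" "op_inv T = S"
proof -
  show "op_invertible T"
    using assms by (auto simp: op_invertible_def)
  from op_inv [OF this] show "op_inv T = S"
    by (metis (no_types, opaque_lifting) assms(2) blinfun_apply_blinfun_compose blinfun_eqI
        id_blinfun.rep_eq id_apply)
qed

lemma stable_representation_at_0: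
  assumes "stable_representation R \<delta> ap bp gp am bm gm" and am: "op_invertible am"
  shows "R 0 = \<delta> - gm \<odot> op_inv am \<odot> bm"
proof -
  have l: "(- op_inv am) \<odot> (- am) = id_blinfun" and r: "(- am) \<odot> (- op_inv am) = id_blinfun"
    using op_inv [OF am] 
    by (metis bounded_bilinear.minus_left bounded_bilinear.minus_right
        bounded_bilinear_blinfun_compose minus_minus)+
  note inv = op_inv_eqI [OF l r]
  have "op_invertible (id_blinfun - 0 *\<^sub>C ap) \<and> op_invertible (0 *\<^sub>C id_blinfun - am) \<longrightarrow>
      R 0 = \<delta> + 0 *\<^sub>C (gp \<odot> op_inv (id_blinfun - 0 *\<^sub>C ap) \<odot> bp)
              + gm \<odot> op_inv (0 *\<^sub>C id_blinfun - am) \<odot> bm"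
    using assms(1) unfolding stable_representation_def by blast
  then have "R 0 = \<delta> + gm \<odot> (- op_inv am) \<odot> bm"
    using inv by (simp add: scaleC_blinfun_zero op_invertible_id)
  then show ?thesis
    by (simp add: bounded_bilinear.minus_left [OF bounded_bilinear_blinfun_compose]
        bounded_bilinear.minus_right [OF bounded_bilinear_blinfun_compose])
qed

definition Ricc1 ::
    "('u::complex_hilbert \<Rightarrow>\<^sub>L 'u) \<Rightarrow>
     ('p::complex_hilbert \<Rightarrow>\<^sub>L 'p) \<Rightarrow> ('u \<Rightarrow>\<^sub>L 'p) \<Rightarrow> ('p \<Rightarrow>\<^sub>L 'u) \<Rightarrow>
     ('m::complex_hilbert \<Rightarrow>\<^sub>L 'm) \<Rightarrow> ('u \<Rightarrow>\<^sub>L 'm) \<Rightarrow> ('m \<Rightarrow>\<^sub>L 'u) \<Rightarrow> ('p \<Rightarrow>\<^sub>L 'm) set"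
  where "Ricc1 \<delta> ap bp gp am bm gm =
    {Q. complex_op Q \<and> op_invertible (\<delta> - gm \<odot> Q \<odot> bp) \<and>
        Q = am \<odot> Q \<odot> ap +
          (bm - am \<odot> Q \<odot> bp) \<odot> op_inv (\<delta> - gm \<odot> Q \<odot> bp) \<odot> (gp - gm \<odot> Q \<odot> ap)}"

text \<open>\<open>Ricc2'\<close> is considered only when \<open>am\<close> and \<open>\<delta> - gm \<odot> op_inv am \<odot> bm\<close> are invertible.\<close>

definition Ricc2' ::
    "('u::complex_hilbert \<Rightarrow>\<^sub>L 'u) \<Rightarrow>
     ('p::complex_hilbert \<Rightarrow>\<^sub>L 'p) \<Rightarrow> ('u \<Rightarrow>\<^sub>L 'p) \<Rightarrow> ('p \<Rightarrow>\<^sub>L 'u) \<Rightarrow>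
     ('m::complex_hilbert \<Rightarrow>\<^sub>L 'm) \<Rightarrow> ('u \<Rightarrow>\<^sub>L 'm) \<Rightarrow> ('m \<Rightarrow>\<^sub>L 'u) \<Rightarrow> ('p \<Rightarrow>\<^sub>L 'm) set"
  where "Ricc2' \<delta> ap bp gp am bm gm =
    {Q. complex_op Q \<and> op_invertible (\<delta> - gm \<odot> Q \<odot> bp) \<and>
        Q = am \<odot> Q \<odot> ap +
          (bm - am \<odot> Q \<odot> bp) \<odot> op_inv (\<delta> - gm \<odot> op_inv am \<odot> bm) \<odot>
          (gp - gm \<odot> op_inv am \<odot> Q)}"

definition alpha_plus_circ ::
    "('u::complex_hilbert \<Rightarrow>\<^sub>L 'u) \<Rightarrow>
     ('p::complex_hilbert \<Rightarrow>\<^sub>L 'p) \<Rightarrow> ('u \<Rightarrow>\<^sub>L 'p) \<Rightarrow> ('p \<Rightarrow>\<^sub>L 'u) \<Rightarrow>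
     ('m::complex_hilbert \<Rightarrow>\<^sub>L 'u) \<Rightarrow> ('p \<Rightarrow>\<^sub>L 'm) \<Rightarrow> ('p \<Rightarrow>\<^sub>L 'p)"
  where "alpha_plus_circ \<delta> ap bp gp gm Q =
    ap - bp \<odot> op_inv (\<delta> - gm \<odot> Q \<odot> bp) \<odot> (gp - gm \<odot> Q \<odot> ap)"

definition alpha_minus_circ ::
    "('u::complex_hilbert \<Rightarrow>\<^sub>L 'u) \<Rightarrow> ('u \<Rightarrow>\<^sub>L 'p::complex_hilbert) \<Rightarrow>
     ('m::complex_hilbert \<Rightarrow>\<^sub>L 'm) \<Rightarrow> ('u \<Rightarrow>\<^sub>L 'm) \<Rightarrow> ('m \<Rightarrow>\<^sub>L 'u) \<Rightarrow> ('p \<Rightarrow>\<^sub>L 'm) \<Rightarrow> ('m \<Rightarrow>\<^sub>L 'm)"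
  where "alpha_minus_circ \<delta> bp am bm gm Q =
    am - (bm - am \<odot> Q \<odot> bp) \<odot> op_inv (\<delta> - gm \<odot> Q \<odot> bp) \<odot> gm"

definition stabilizing1 ::
    "('u::complex_hilbert \<Rightarrow>\<^sub>L 'u) \<Rightarrow>
     ('p::complex_hilbert \<Rightarrow>\<^sub>L 'p) \<Rightarrow> ('u \<Rightarrow>\<^sub>L 'p) \<Rightarrow> ('p \<Rightarrow>\<^sub>L 'u) \<Rightarrow>
     ('m::complex_hilbert \<Rightarrow>\<^sub>L 'm) \<Rightarrow> ('u \<Rightarrow>\<^sub>L 'm) \<Rightarrow> ('m \<Rightarrow>\<^sub>L 'u) \<Rightarrow> ('p \<Rightarrow>\<^sub>L 'm) \<Rightarrow> bool"
  where "stabilizing1 \<delta> ap bp gp am bm gm Q \<longleftrightarrow>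
    op_stable (alpha_plus_circ \<delta> ap bp gp gm Q) \<and>
    op_stable (alpha_minus_circ \<delta> bp am bm gm Q)"

definition stabilizing2 ::
    "('u::complex_hilbert \<Rightarrow>\<^sub>L 'u) \<Rightarrow>
     ('p::complex_hilbert \<Rightarrow>\<^sub>L 'p) \<Rightarrow> ('u \<Rightarrow>\<^sub>L 'p) \<Rightarrow> ('p \<Rightarrow>\<^sub>L 'u) \<Rightarrow>
     ('m::complex_hilbert \<Rightarrow>\<^sub>L 'm) \<Rightarrow> ('u \<Rightarrow>\<^sub>L 'm) \<Rightarrow> ('m \<Rightarrow>\<^sub>L 'u) \<Rightarrow> ('p \<Rightarrow>\<^sub>L 'm) \<Rightarrow> bool"
  where "stabilizing2 \<delta> ap bp gp am bm gm Q \<longleftrightarrow>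
    op_stable
      (ap - bp \<odot> op_inv (\<delta> - gm \<odot> op_inv am \<odot> bm) \<odot> (gp - gm \<odot> op_inv am \<odot> Q)) \<and>
    op_antistable
      (op_inv am + op_inv am \<odot> (bm - am \<odot> Q \<odot> bp) \<odot>
        op_inv (\<delta> - gm \<odot> op_inv am \<odot> bm) \<odot> gm \<odot> op_inv am)"

end

theory Submission
  imports Defs "HOL-Complex_Analysis.Cauchy_Integral_Formula"
begin

text \<open>
  Write \<open>D = \<delta> - \<gamma>\<^sub>- Q \<beta>\<^sub>+\<close>, \<open>W = \<beta>\<^sub>- - \<alpha>\<^sub>- Q \<beta>\<^sub>+\<close>, \<open>V = \<gamma>\<^sub>+ - \<gamma>\<^sub>- Q \<alpha>\<^sub>+\<close> and
  \<open>\<Delta> = R(0) = \<delta> - \<gamma>\<^sub>- \<alpha>\<^sub>-\<^sup>-\<^sup>1 \<beta>\<^sub>-\<close>, so that \<open>\<Delta> = D - \<gamma>\<^sub>- \<alpha>\<^sub>-\<^sup>-\<^sup>1 W\<close>.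

  If \<open>Q\<close> solves the first Riccati equation, multiplying the equation by \<open>\<gamma>\<^sub>- \<alpha>\<^sub>-\<^sup>-\<^sup>1\<close> and
  subtracting it from \<open>\<gamma>\<^sub>+\<close> gives
  \<open>\<gamma>\<^sub>+ - \<gamma>\<^sub>- \<alpha>\<^sub>-\<^sup>-\<^sup>1 Q = \<Delta> D\<^sup>-\<^sup>1 V\<close>, that is, \<open>\<Delta>\<^sup>-\<^sup>1 (\<gamma>\<^sub>+ - \<gamma>\<^sub>- \<alpha>\<^sub>-\<^sup>-\<^sup>1 Q) = D\<^sup>-\<^sup>1 V\<close> (lemma
  \<open>Ricc1_gain_eq\<close>). The same identity follows from the second equation if \<open>D\<close> is invertible
  (lemma \<open>Ricc2'_gain_eq\<close>). Hence the two equations have the same solutions with \<open>D\<close> invertible,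
  and the two expressions for \<open>\<alpha>\<^sub>+\<^sup>\<circ>\<close> agree. By the Woodbury formula (lemma \<open>woodbury\<close>) the
  operator required to be anti-stable in the second stabilizing condition is the inverse of \<open>\<alpha>\<^sub>-\<^sup>\<circ>\<close>,
  and an invertible operator is stable if and only if its inverse is anti-stable. Thus the two
  stabilizing conditions are equivalent.

  For uniqueness, the difference \<open>E\<close> of two solutions \<open>Q\<close> and \<open>Q'\<close> satisfies \<open>E = M E N\<close>, where \<open>M\<close>
  is \<open>\<alpha>\<^sub>-\<^sup>\<circ>\<close> for \<open>Q\<close> and \<open>N\<close> is \<open>\<alpha>\<^sub>+\<^sup>\<circ>\<close> for \<open>Q'\<close> (lemma \<open>Ricc1_diff_eq\<close>). If \<open>M\<close> and \<open>N\<close> are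
  stable, then \<open>E = 0\<close> (lemma \<open>stein_equation_stable_eq_0\<close>): instead of iterating to
  \<open>E = M\<^sup>n E N\<^sup>n\<close>, which would need the spectral radius formula, the proof glues two resolvents to
  an entire function and applies Liouville's theorem. This needs only that invertibility is
  preserved by small perturbations, that the inverse of an operator pencil is analytic, and that
  \<open>(w - M)\<^sup>-\<^sup>1\<close> vanishes at infinity.
\<close>

section \<open>Scalar multiplication and the inner product\<close>

lemma scaleC_diff_left: "(z - w) *\<^sub>C (x :: 'a::complex_hilbert) = z *\<^sub>C x - w *\<^sub>C x"
  using scaleC_add_left [of "z - w" w x] by simp

lemma scaleC_diff_right: "z *\<^sub>C (x - y) = z *\<^sub>C x - z *\<^sub>C (y :: 'a::complex_hilbert)"
  using scaleC_add_right [of z "x - y" y] by simp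

lemma scaleC_zero_left: "0 *\<^sub>C (x :: 'a::complex_hilbert) = 0"
  using scaleC_diff_left [of 0 0 x] by simp

lemma scaleC_minus_left: "(- z) *\<^sub>C (x :: 'a::complex_hilbert) = - (z *\<^sub>C x)"
  using scaleC_diff_left [of 0 z x] by (simp add: scaleC_zero_left)

lemma scaleC_zero_right: "z *\<^sub>C (0 :: 'a::complex_hilbert) = 0"
  using scaleC_diff_right [of z 0 0] by simp

lemma scaleC_minus_right: "z *\<^sub>C (- x) = - (z *\<^sub>C (x :: 'a::complex_hilbert))"
  using scaleC_diff_right [of z 0 x] by (simp add: scaleC_zero_right)

lemma scaleC_one: "1 *\<^sub>C (x :: 'a::complex_hilbert) = x"
  using scaleC_of_real [of 1 x] by simp

lemma cinner_zero_left: "cinner (0 :: 'a::complex_hilbert) y = 0"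
  using cinner_add_left [of 0 0 y] by simp

lemma cinner_diff_left: "cinner (x - y) v = cinner x v - cinner y (v :: 'a::complex_hilbert)"
  using cinner_add_left [of "x - y" y v] by simp

lemma Re_cinner: "Re (cinner x y) = ((norm (x + y))\<^sup>2 - (norm x)\<^sup>2 - (norm y)\<^sup>2) / 2"
  for x y :: "'a::complex_hilbert"
proof -
  \<comment> \<open>Expand the square; the two mixed terms are conjugate to each other.\<close>
  have "cinner (x + y) (x + y) = cinner x x + cinner y x + (cinner x y + cinner y y)"
    by (metis (no_types, opaque_lifting) add.assoc add.commute cinner_add_left cinner_commute
        complex_cnj_add)
  moreover have "Re (cinner y x) = Re (cinner x y)"
    by (metis cinner_commute complex_cnj cnj.simps(1))
  ultimately show ?thesis
    by (simp add: cinner_self complex_eq_iff)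
qed

text \<open>By \<open>Re_cinner\<close>, the inner product is a continuous expression in norms.\<close>

lemma tendsto_cinner_left:
  assumes "(f \<longlongrightarrow> l) F"
  shows "((\<lambda>t. cinner (f t) (y :: 'a::complex_hilbert)) \<longlongrightarrow> cinner l y) F"
proof -
  have Re: "((\<lambda>t. Re (cinner (g t) y)) \<longlongrightarrow> Re (cinner k y)) F"
    if "(g \<longlongrightarrow> k) F" for g k
    unfolding Re_cinner using that by (intro tendsto_intros) auto
  have Im: "Im (cinner x y) = Re (cinner ((- \<i>) *\<^sub>C x) y)" for x
    by (simp add: cinner_scaleC_left)
  have "((\<lambda>t. (- \<i>) *\<^sub>C f t) \<longlongrightarrow> (- \<i>) *\<^sub>C l) F"
    by (rule bounded_linear.tendsto [OF bounded_linear_scaleC assms])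
  then show ?thesis
    unfolding tendsto_complex_iff Im using Re assms by blast
qed

section \<open>Algebra of bounded operators\<close>

lemmas compose_add_left = bounded_bilinear.add_left [OF bounded_bilinear_blinfun_compose]
lemmas compose_add_right = bounded_bilinear.add_right [OF bounded_bilinear_blinfun_compose]
lemmas compose_diff_left = bounded_bilinear.diff_left [OF bounded_bilinear_blinfun_compose]
lemmas compose_diff_right = bounded_bilinear.diff_right [OF bounded_bilinear_blinfun_compose]
lemmas compose_distribs =
  compose_add_left compose_add_right compose_diff_left compose_diff_right

lemma compose_assoc: "A \<odot> B \<odot> C = A \<odot> (B \<odot> C)"
  by (rule blinfun_eqI) simp

lemma compose_id_left: "id_blinfun \<odot> A = A"
  by (rule blinfun_eqI) simp

lemma compose_id_right: "A \<odot> id_blinfun = A"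
  by (rule blinfun_eqI) simp

lemma op_inv_cancel:
  assumes "op_invertible T"
  shows "op_inv T \<odot> (T \<odot> A) = A" "T \<odot> (op_inv T \<odot> B) = B"
  using op_inv [OF assms] by (simp_all add: compose_assoc [symmetric] compose_id_left)

lemma op_inv_apply:
  assumes "op_invertible T"
  shows "op_inv T (T x) = x" "T (op_inv T y) = y"
  using op_inv [OF assms] by (metis blinfun_apply_blinfun_compose blinfun_apply_id_blinfun)+

lemma op_invertible_op_inv: "op_invertible T \<Longrightarrow> op_invertible (op_inv T)"
  using op_inv op_inv_eqI(1) by blast

lemma op_invertible_compose:
  assumes "op_invertible S" "op_invertible T"
  shows "op_invertible (S \<odot> T)"
  by (rule op_inv_eqI(1) [of "op_inv T \<odot> op_inv S"])
    (simp_all add: compose_assoc op_inv_cancel assms op_inv)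

lemma complex_op_compose: "complex_op S \<Longrightarrow> complex_op T \<Longrightarrow> complex_op (S \<odot> T)"
  by (simp add: complex_op_def)

lemma complex_op_diff: "complex_op S \<Longrightarrow> complex_op T \<Longrightarrow> complex_op (S - T)"
  by (simp add: complex_op_def blinfun.diff_left scaleC_diff_right)

lemma norm_scaleC_blinfun_le:
  "norm (z *\<^sub>C (T :: 'a::real_normed_vector \<Rightarrow>\<^sub>L 'b::complex_hilbert)) \<le> cmod z * norm T"
proof (rule norm_blinfun_bound)
  fix x
  show "norm ((z *\<^sub>C T) x) \<le> cmod z * norm T * norm x"
    using norm_blinfun [of T x]
    by (simp add: scaleC_blinfun.rep_eq norm_scaleC mult.assoc mult_left_mono)
qed simp

lemma op_invertible_scaleC_id:
  assumes "z \<noteq> 0"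
  shows "op_invertible (z *\<^sub>C (id_blinfun :: 'a::complex_hilbert \<Rightarrow>\<^sub>L 'a))"
    and "op_inv (z *\<^sub>C (id_blinfun :: 'a \<Rightarrow>\<^sub>L 'a)) = inverse z *\<^sub>C id_blinfun"
proof -
  have "(inverse z *\<^sub>C id_blinfun) \<odot> (z *\<^sub>C id_blinfun) = (id_blinfun :: 'a \<Rightarrow>\<^sub>L 'a)"
    "(z *\<^sub>C id_blinfun) \<odot> (inverse z *\<^sub>C id_blinfun) = (id_blinfun :: 'a \<Rightarrow>\<^sub>L 'a)"
    using assms
    by (auto intro!: blinfun_eqI simp: scaleC_blinfun.rep_eq scaleC_scaleC scaleC_one)
  from op_inv_eqI [OF this]
  show "op_invertible (z *\<^sub>C (id_blinfun :: 'a \<Rightarrow>\<^sub>L 'a))"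
    "op_inv (z *\<^sub>C (id_blinfun :: 'a \<Rightarrow>\<^sub>L 'a)) = inverse z *\<^sub>C id_blinfun"
    by auto
qed

lemma op_invertible_scaleC:
  assumes "z \<noteq> 0" and T: "op_invertible T"
  shows "op_invertible (z *\<^sub>C (T :: 'a::real_normed_vector \<Rightarrow>\<^sub>L 'b::complex_hilbert))"
proof -
  have "z *\<^sub>C T = (z *\<^sub>C id_blinfun) \<odot> T"
    by (rule blinfun_eqI) (simp add: scaleC_blinfun.rep_eq)
  then show ?thesis
    using op_invertible_compose [OF op_invertible_scaleC_id(1) T] assms(1) by metis
qed

section \<open>Perturbation of invertible operators\<close>

lemma op_invertible_id_minus:
  fixes E :: "'a::banach \<Rightarrow>\<^sub>L 'a"
  assumes "norm E < 1"
  shows "op_invertible (id_blinfun - E)"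
    and "norm (op_inv (id_blinfun - E)) \<le> 1 / (1 - norm E)"
proof -
  \<comment> \<open>\<open>x - E x = y\<close> says that \<open>x\<close> is the fixed point of a contraction.\<close>
  have ex: "\<exists>!x. y + E x = x" for y
  proof (rule banach_fix_type [of "norm E"])
    show "\<forall>x x'. dist (y + E x) (y + E x') \<le> norm E * dist x x'"
      using norm_blinfun [of E] by (simp add: dist_norm blinfun.diff_right [symmetric])
  qed (use assms in auto)
  then obtain s where s: "y + E (s y) = s y" for y
    by metis
  have uniq: "x = s y" if "x - E x = y" for x y
    using that ex s by (metis diff_add_cancel add.commute)
  have bound: "norm (s y) \<le> norm y * (1 / (1 - norm E))" for y
  proof -
    have "norm (s y) \<le> norm y + norm E * norm (s y)"
      using norm_triangle_ineq [of y "E (s y)"] norm_blinfun [of E "s y"] s [of y] by simp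
    then show ?thesis
      using assms by (simp add: field_simps)
  qed
  have ss: "s y - E (s y) = y" for y
    using s [of y] by (simp add: algebra_simps)
  have bl: "bounded_linear s"
  proof (rule bounded_linear_intro [OF _ _ bound])
    show "s (x + y) = s x + s y" for x y
      using ss [of x] ss [of y]
      by (intro uniq [symmetric]) (simp add: blinfun.add_right add_diff_add ss)
    show "s (r *\<^sub>R x) = r *\<^sub>R s x" for r x
      by (intro uniq [symmetric])
        (simp add: blinfun.scaleR_right scaleR_diff_right [symmetric] ss)
  qed
  define S where "S = Blinfun s"
  have S: "blinfun_apply S = s"
    unfolding S_def by (rule bounded_linear_Blinfun_apply [OF bl])
  have "S \<odot> (id_blinfun - E) = id_blinfun" "(id_blinfun - E) \<odot> S = id_blinfun"
    by (auto intro!: blinfun_eqI simp: S blinfun.diff_left ss uniq [OF refl, symmetric])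
  note inv = op_inv_eqI [OF this]
  show "op_invertible (id_blinfun - E)"
    by (rule inv(1))
  show "norm (op_inv (id_blinfun - E)) \<le> 1 / (1 - norm E)"
    unfolding inv(2) using assms bound
    by (intro norm_blinfun_bound) (auto simp: S mult.commute)
qed

text \<open>With \<open>E = T\<^sup>-\<^sup>1 (T - S)\<close>, the operator \<open>S\<close> factors as \<open>T (1 - E)\<close>.\<close>

lemma op_invertible_perturb:
  fixes S T :: "'a::banach \<Rightarrow>\<^sub>L 'b::banach"
  assumes T: "op_invertible T" and small: "norm (op_inv T) * norm (S - T) \<le> c" "c < 1"
  shows "op_invertible S" and "norm (op_inv S) \<le> norm (op_inv T) / (1 - c)"
proof -
  define E where "E = op_inv T \<odot> (T - S)"
  have nE: "norm E \<le> c"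
    using norm_blinfun_compose [of "op_inv T" "T - S"] small(1)
    by (simp add: E_def norm_minus_commute)
  note inv = op_invertible_id_minus [of E]
  have S: "S = T \<odot> (id_blinfun - E)"
    by (simp add: E_def compose_distribs compose_id_right op_inv_cancel [OF T])
  have invE: "op_invertible (id_blinfun - E)"
    using inv nE small by simp
  show "op_invertible S"
    unfolding S by (rule op_invertible_compose [OF T invE])
  have "op_inv S = op_inv (id_blinfun - E) \<odot> op_inv T"
    unfolding S by (rule op_inv_eqI(2))
      (simp_all add: compose_assoc op_inv_cancel T invE op_inv)
  then have "norm (op_inv S) \<le> norm (op_inv (id_blinfun - E)) * norm (op_inv T)"
    by (simp add: norm_blinfun_compose)
  also have "\<dots> \<le> 1 / (1 - c) * norm (op_inv T)"
  proof (rule mult_right_mono)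
    have "norm (op_inv (id_blinfun - E)) \<le> 1 / (1 - norm E)"
      using inv nE small by simp
    also have "\<dots> \<le> 1 / (1 - c)"
      using nE small by (intro divide_left_mono mult_pos_pos) auto
    finally show "norm (op_inv (id_blinfun - E)) \<le> 1 / (1 - c)" .
  qed simp
  finally show "norm (op_inv S) \<le> norm (op_inv T) / (1 - c)"
    by simp
qed

section \<open>Inverses of linear operator pencils\<close>

lemma pencil_invertible_near:
  fixes A B :: "'a::complex_hilbert \<Rightarrow>\<^sub>L 'b::complex_hilbert"
  assumes "op_invertible (A + w0 *\<^sub>C B)"
  shows "\<exists>K. \<forall>\<^sub>F w in nhds w0. op_invertible (A + w *\<^sub>C B) \<and> norm (op_inv (A + w *\<^sub>C B)) \<le> K"
proof -
  let ?L = "\<lambda>w. A + w *\<^sub>C B" and ?T = "op_inv (A + w0 *\<^sub>C B)"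
  have le: "norm (?L w - ?L w0) \<le> cmod (w - w0) * norm B" for w
  proof -
    have "?L w - ?L w0 = (w - w0) *\<^sub>C B"
      by (rule blinfun_eqI)
        (simp add: scaleC_blinfun.rep_eq blinfun.diff_left blinfun.add_left scaleC_diff_left)
    then show ?thesis
      using norm_scaleC_blinfun_le by metis
  qed
  have "((\<lambda>w. norm ?T * (cmod (w - w0) * norm B)) \<longlongrightarrow> norm ?T * (cmod (w0 - w0) * norm B)) (nhds w0)"
    by (intro tendsto_intros filterlim_ident)
  then have "\<forall>\<^sub>F w in nhds w0. norm ?T * (cmod (w - w0) * norm B) < 1 / 2"
    by (rule order_tendstoD) simp
  then have "\<forall>\<^sub>F w in nhds w0. op_invertible (?L w) \<and> norm (op_inv (?L w)) \<le> norm ?T / (1 - 1 / 2)"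
  proof (rule eventually_mono)
    fix w
    assume "norm ?T * (cmod (w - w0) * norm B) < 1 / 2"
    then have "norm ?T * norm (?L w - ?L w0) \<le> 1 / 2"
      using mult_left_mono [OF le [of w], of "norm ?T"] by simp
    from op_invertible_perturb [OF assms this]
    show "op_invertible (?L w) \<and> norm (op_inv (?L w)) \<le> norm ?T / (1 - 1 / 2)"
      by simp
  qed
  then show ?thesis
    by blast
qed

text \<open>The pencils of interest are \<open>w - M\<close> and \<open>1 - w N\<close>. The derivative is that of the
  operator-valued inverse, \<open>- L\<^sup>-\<^sup>1 B L\<^sup>-\<^sup>1\<close>, read off on a matrix element.\<close>

lemma pencil_has_derivative:
  fixes A B :: "'a::complex_hilbert \<Rightarrow>\<^sub>L 'b::complex_hilbert"
    and C :: "'a \<Rightarrow>\<^sub>L 'c::complex_hilbert"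
  assumes cop: "complex_op A" "complex_op B" "complex_op C"
    and inv0: "op_invertible (A + w0 *\<^sub>C B)"
  shows "((\<lambda>w. cinner (C (op_inv (A + w *\<^sub>C B) x)) y) has_field_derivative
      - cinner (C (op_inv (A + w0 *\<^sub>C B) (B (op_inv (A + w0 *\<^sub>C B) x)))) y) (at w0)"
proof -
  define L where "L w = A + w *\<^sub>C B" for w
  define F0 where "F0 = op_inv (L w0)"
  define u where "u w = op_inv (L w) x" for w
  obtain K where K: "\<forall>\<^sub>F w in nhds w0. op_invertible (L w) \<and> norm (op_inv (L w)) \<le> K"
    using pencil_invertible_near [OF inv0] unfolding L_def by blast
  then have K': "\<forall>\<^sub>F w in at w0. op_invertible (L w) \<and> norm (op_inv (L w)) \<le> K"
    by (simp add: eventually_nhds_conv_at)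
  have inv0': "op_invertible (L w0)"
    using inv0 by (simp add: L_def)
  have "complex_op (L w0)"
    using cop by (simp add: L_def complex_op_def blinfun.add_left scaleC_blinfun.rep_eq
        scaleC_add_right scaleC_scaleC mult.commute)
  then have cF0: "complex_op F0"
    unfolding F0_def using inv0' by (rule complex_op_op_inv)
  \<comment> \<open>The resolvent identity for the pencil.\<close>
  have res: "u w - u w0 = (w0 - w) *\<^sub>C F0 (B (u w))" if "op_invertible (L w)" for w
  proof -
    have "u w - u w0 = F0 (L w0 (u w)) - F0 (L w (u w))"
      using that inv0' by (simp add: u_def F0_def op_inv_apply)
    also have "\<dots> = F0 ((w0 - w) *\<^sub>C B (u w))"
      by (simp add: L_def blinfun.add_left blinfun.diff_right [symmetric] scaleC_blinfun.rep_eq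
          scaleC_diff_left)
    finally show ?thesis
      using cF0 by (simp add: complex_op_def)
  qed
  have "(u \<longlongrightarrow> u w0) (at w0)"
  proof (rule metric_tendsto_imp_tendsto)
    show "((\<lambda>w. cmod (w0 - w) * (norm (F0 \<odot> B) * (K * norm x))) \<longlongrightarrow> 0) (at w0)"
      by (auto intro!: tendsto_eq_intros)
    show "\<forall>\<^sub>F w in at w0. dist (u w) (u w0)
        \<le> dist (cmod (w0 - w) * (norm (F0 \<odot> B) * (K * norm x))) 0"
      using K'
    proof (rule eventually_mono)
      fix w
      assume w: "op_invertible (L w) \<and> norm (op_inv (L w)) \<le> K"
      have "norm (u w) \<le> K * norm x"
        unfolding u_def using w norm_blinfun [of "op_inv (L w)" x]
        by (meson mult_right_mono norm_ge_zero order_trans)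
      then have "norm (F0 (B (u w))) \<le> norm (F0 \<odot> B) * (K * norm x)"
        using norm_blinfun [of "F0 \<odot> B" "u w"] mult_left_mono [of "norm (u w)" "K * norm x" "norm (F0 \<odot> B)"]
        by simp
      then have "norm (u w - u w0) \<le> cmod (w0 - w) * (norm (F0 \<odot> B) * (K * norm x))"
        using w by (simp add: res norm_scaleC mult_left_mono)
      then show "dist (u w) (u w0) \<le> dist (cmod (w0 - w) * (norm (F0 \<odot> B) * (K * norm x))) 0"
        by (simp add: dist_norm del: norm_mult)
    qed
  qed
  then have "((\<lambda>w. cinner (C (F0 (B (u w)))) y) \<longlongrightarrow> cinner (C (F0 (B (u w0)))) y) (at w0)"
    by (intro tendsto_cinner_left bounded_linear.tendsto [OF blinfun.bounded_linear_right])
  then have lim: "((\<lambda>w. - cinner (C (F0 (B (u w)))) y) \<longlongrightarrow> - cinner (C (F0 (B (u w0)))) y) (at w0)"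
    by (rule tendsto_minus)
  have "\<forall>\<^sub>F w in at w0. w \<noteq> w0"
    by (simp add: eventually_at_filter)
  with K' have "\<forall>\<^sub>F w in at w0. - cinner (C (F0 (B (u w)))) y
      = (cinner (C (u w)) y - cinner (C (u w0)) y) / (w - w0)"
  proof eventually_elim
    fix w
    assume w: "op_invertible (L w) \<and> norm (op_inv (L w)) \<le> K" and "w \<noteq> w0"
    have "cinner (C (u w)) y - cinner (C (u w0)) y = (w0 - w) * cinner (C (F0 (B (u w)))) y"
      using cop(3) w
      by (simp add: cinner_diff_left [symmetric] blinfun.diff_right [symmetric] res
          complex_op_def cinner_scaleC_left)
    also have "\<dots> = (w - w0) * (- cinner (C (F0 (B (u w)))) y)"
      by (simp add: algebra_simps)
    finally show "- cinner (C (F0 (B (u w)))) y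
        = (cinner (C (u w)) y - cinner (C (u w0)) y) / (w - w0)"
      using \<open>w \<noteq> w0\<close> by simp
  qed
  from Lim_transform_eventually [OF lim this] show ?thesis
    by (simp add: has_field_derivative_iff u_def F0_def L_def)
qed

lemma resolvent_tendsto_0:
  fixes M :: "'a::complex_hilbert \<Rightarrow>\<^sub>L 'a"
  shows "((\<lambda>w. op_inv (w *\<^sub>C id_blinfun - M) x) \<longlongrightarrow> 0) at_infinity"
proof (rule tendsto_0_le)
  show "((\<lambda>w :: complex. inverse w) \<longlongrightarrow> 0) at_infinity"
    by (rule tendsto_inverse_0)
  show "\<forall>\<^sub>F w in at_infinity. norm (op_inv (w *\<^sub>C id_blinfun - M) x)
      \<le> norm (inverse w) * (2 * norm x)"
    unfolding eventually_at_infinity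
  proof (intro exI allI impI)
    fix w :: complex
    assume w: "2 * norm M + 1 \<le> norm w"
    let ?I = "w *\<^sub>C (id_blinfun :: 'a \<Rightarrow>\<^sub>L 'a)"
    have w0: "w \<noteq> 0"
      using w norm_ge_zero [of M] by (metis add_nonneg_pos less_le_not_le mult_nonneg_nonneg
          norm_zero zero_le_numeral zero_less_one)
    have "norm (op_inv ?I) \<le> cmod (inverse w) * norm (id_blinfun :: 'a \<Rightarrow>\<^sub>L 'a)"
      using norm_scaleC_blinfun_le w0 by (simp add: op_invertible_scaleC_id)
    also have "\<dots> \<le> cmod (inverse w) * 1"
      by (intro mult_left_mono norm_blinfun_id_le) simp
    finally have nI: "norm (op_inv ?I) \<le> inverse (norm w)"
      by (simp add: norm_inverse)
    have "norm (op_inv ?I) * norm M \<le> inverse (norm w) * norm M"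
      by (rule mult_right_mono [OF nI]) simp
    also have "\<dots> \<le> 1 / 2"
      using w w0 by (simp add: field_simps)
    finally have "norm (op_inv ?I) * norm ((?I - M) - ?I) \<le> 1 / 2"
      by simp
    from op_invertible_perturb(2) [OF op_invertible_scaleC_id(1) [OF w0] this]
    have "norm (op_inv (?I - M)) \<le> 2 * inverse (norm w)"
      using nI by simp
    then have "norm (op_inv (?I - M)) * norm x \<le> 2 * inverse (norm w) * norm x"
      by (rule mult_right_mono) simp
    then show "norm (op_inv (?I - M) x) \<le> norm (inverse w) * (2 * norm x)"
      using norm_blinfun [of "op_inv (?I - M)" x] by (simp add: norm_inverse mult_ac)
  qed
qed

section \<open>Stable operators\<close>

lemma op_stableD:
  assumes "op_stable T" "1 \<le> cmod z"
  shows "op_invertible (z *\<^sub>C id_blinfun - T)"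
  using assms by (force simp: op_stable_def op_spectrum_def)

lemma op_stableD_disc:
  assumes "op_stable T" "cmod z \<le> 1"
  shows "op_invertible (id_blinfun - z *\<^sub>C T)"
proof (cases "z = 0")
  case True
  then show ?thesis
    by (simp add: scaleC_blinfun_zero op_invertible_id)
next
  case False
  have "op_invertible (inverse z *\<^sub>C id_blinfun - T)"
    using assms False by (intro op_stableD) (auto simp: norm_inverse one_le_inverse)
  then have "op_invertible (z *\<^sub>C (inverse z *\<^sub>C id_blinfun - T))"
    using False by (rule op_invertible_scaleC [rotated])
  moreover have "z *\<^sub>C (inverse z *\<^sub>C id_blinfun - T) = id_blinfun - z *\<^sub>C T"
    using False by (intro blinfun_eqI)
      (simp add: scaleC_blinfun.rep_eq blinfun.diff_left scaleC_diff_right scaleC_scaleC scaleC_one)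
  ultimately show ?thesis
    by simp
qed

text \<open>The reason is \<open>z - T\<^sup>-\<^sup>1 = - z (z\<^sup>-\<^sup>1 - T) T\<^sup>-\<^sup>1\<close>.\<close>

lemma op_invertible_resolvent_op_inv:
  fixes T :: "'a::complex_hilbert \<Rightarrow>\<^sub>L 'a"
  assumes T: "complex_op T" "op_invertible T" and "z \<noteq> 0"
    and inv: "op_invertible (inverse z *\<^sub>C id_blinfun - T)"
  shows "op_invertible (z *\<^sub>C id_blinfun - op_inv T)"
proof -
  have "z *\<^sub>C id_blinfun - op_inv T
      = (- z) *\<^sub>C ((inverse z *\<^sub>C id_blinfun - T) \<odot> op_inv T)"
    using \<open>z \<noteq> 0\<close> by (intro blinfun_eqI)
      (simp add: scaleC_blinfun.rep_eq blinfun.diff_left scaleC_diff_right scaleC_scaleC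
        scaleC_one scaleC_minus_left op_inv_apply [OF T(2)])
  moreover have "op_invertible ((- z) *\<^sub>C ((inverse z *\<^sub>C id_blinfun - T) \<odot> op_inv T))"
    using \<open>z \<noteq> 0\<close>
    by (intro op_invertible_scaleC op_invertible_compose inv op_invertible_op_inv T) auto
  ultimately show ?thesis
    by simp
qed

lemma op_antistable_op_inv_iff:
  fixes T :: "'a::complex_hilbert \<Rightarrow>\<^sub>L 'a"
  assumes T: "complex_op T" "op_invertible T"
  shows "op_antistable (op_inv T) \<longleftrightarrow> op_stable T"
proof
  assume st: "op_stable T"
  have "op_invertible (z *\<^sub>C id_blinfun - op_inv T)" if "cmod z \<le> 1" for z
  proof (cases "z = 0")
    case True
    have "z *\<^sub>C id_blinfun - op_inv T = (- 1) *\<^sub>C op_inv T"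
      unfolding True
      by (rule blinfun_eqI) (simp add: scaleC_blinfun.rep_eq blinfun.diff_left blinfun.minus_left
          scaleC_minus_left scaleC_one scaleC_zero_left)
    then show ?thesis
      using op_invertible_scaleC [of "- 1" "op_inv T"] op_invertible_op_inv [OF T(2)] by simp
  next
    case False
    with that have "1 \<le> cmod (inverse z)"
      by (simp add: norm_inverse one_le_inverse)
    then show ?thesis
      using op_invertible_resolvent_op_inv [OF T False] op_stableD [OF st] by blast
  qed
  then show "op_antistable (op_inv T)"
    by (auto simp: op_antistable_def op_spectrum_def)
next
  assume an: "op_antistable (op_inv T)"
  have "op_inv (op_inv T) = T"
    by (rule op_inv_eqI(2)) (simp_all add: op_inv T)
  moreover have "op_invertible (z *\<^sub>C id_blinfun - op_inv (op_inv T))" if "1 \<le> cmod z" for z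
  proof (rule op_invertible_resolvent_op_inv)
    have "cmod (inverse z) \<le> 1"
      using that by (simp add: norm_inverse inverse_le_1_iff)
    then show "op_invertible (inverse z *\<^sub>C id_blinfun - op_inv T)"
      using an by (force simp: op_antistable_def op_spectrum_def)
  qed (use that T in \<open>auto intro: complex_op_op_inv op_invertible_op_inv\<close>)
  ultimately show "op_stable T"
    by (force simp: op_stable_def op_spectrum_def)
qed

text \<open>The function \<open>- E (1 - w N)\<^sup>-\<^sup>1\<close> is analytic near the closed unit disc, \<open>(w - M)\<^sup>-\<^sup>1 M E\<close> is
  analytic near its exterior and vanishes at infinity, and \<open>E = M E N\<close> makes them equal where both
  are defined. By Liouville's theorem the entire function that they form is zero; its value
  at \<open>0\<close> is \<open>- E\<close>. Liouville's theorem is applied to the scalar matrix elements.\<close>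

lemma stein_equation_stable_eq_0:
  fixes M :: "'m::complex_hilbert \<Rightarrow>\<^sub>L 'm" and N :: "'p::complex_hilbert \<Rightarrow>\<^sub>L 'p"
    and E :: "'p \<Rightarrow>\<^sub>L 'm"
  assumes cop: "complex_op M" "complex_op N" "complex_op E"
    and st: "op_stable M" "op_stable N" and E: "E = M \<odot> E \<odot> N"
  shows "E = 0"
proof -
  have Ex: "M (E (N v)) = E v" for v
    using E by (metis blinfun_apply_blinfun_compose)
  have cid: "complex_op (id_blinfun :: 'x::complex_hilbert \<Rightarrow>\<^sub>L 'x)"
    by (simp add: complex_op_def)
  have cneg: "complex_op (- T)" if "complex_op T" for T :: "'x::complex_hilbert \<Rightarrow>\<^sub>L 'y::complex_hilbert"
    using that by (simp add: complex_op_def blinfun.minus_left scaleC_minus_right)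
  have pencilN: "id_blinfun + w *\<^sub>C (- N) = id_blinfun - w *\<^sub>C N" for w
    by (rule blinfun_eqI) (simp add: scaleC_blinfun.rep_eq blinfun.diff_left blinfun.add_left
        blinfun.minus_left scaleC_minus_right)
  have pencilM: "- M + w *\<^sub>C id_blinfun = w *\<^sub>C id_blinfun - M" for w
    by simp
  have zero: "E x = 0" for x
  proof -
    \<comment> \<open>With this choice, the matrix element at \<open>w = 0\<close> is \<open>- (norm (E x))\<^sup>2\<close>.\<close>
    define y where "y = E x"
    define f where "f w = cinner ((- E) (op_inv (id_blinfun - w *\<^sub>C N) x)) y" for w
    \<comment> \<open>The factor \<open>id_blinfun\<close> plays the role of \<open>C\<close> in \<open>pencil_has_derivative\<close>.\<close>
    define g where "g w = cinner (id_blinfun (op_inv (w *\<^sub>C id_blinfun - M) (M (E x)))) y" for w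
    define h where "h w = (if op_invertible (id_blinfun - w *\<^sub>C N) then f w else g w)" for w
    have fg: "f w = g w"
      if "op_invertible (id_blinfun - w *\<^sub>C N)" "op_invertible (w *\<^sub>C id_blinfun - M)" for w
    proof -
      define v where "v = op_inv (id_blinfun - w *\<^sub>C N) x"
      have x: "x = v - w *\<^sub>C N v"
        using op_inv_apply(2) [OF that(1), of x]
        by (simp add: v_def blinfun.diff_left scaleC_blinfun.rep_eq)
      have "M (E x) = (w *\<^sub>C id_blinfun - M) ((- E) v)"
        using cop Ex [of v]
        by (simp add: x blinfun.diff_left blinfun.diff_right blinfun.minus_left
            blinfun.minus_right complex_op_def scaleC_blinfun.rep_eq scaleC_minus_right)
      then show ?thesis
        by (simp add: f_def g_def v_def [symmetric] op_inv_apply [OF that(2)])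
    qed
    have df: "\<exists>D. (f has_field_derivative D) (at w)"
      if "op_invertible (id_blinfun - w *\<^sub>C N)" for w
      using pencil_has_derivative [OF cid cneg [OF cop(2)] cneg [OF cop(3)], of w x y] that
      unfolding f_def pencilN by blast
    have dg: "\<exists>D. (g has_field_derivative D) (at w)"
      if "op_invertible (w *\<^sub>C id_blinfun - M)" for w
      using pencil_has_derivative [OF cneg [OF cop(1)] cid cid, of w "M (E x)" y] that
      unfolding g_def pencilM by blast
    have "\<exists>D. (h has_field_derivative D) (at w)" for w
    proof (cases "op_invertible (id_blinfun - w *\<^sub>C N)")
      case True
      then have "\<forall>\<^sub>F w' in nhds w. op_invertible (id_blinfun - w' *\<^sub>C N)"
        using pencil_invertible_near [of id_blinfun w "- N"] unfolding pencilN
        by (auto elim: eventually_mono)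
      then have "\<forall>\<^sub>F w' in nhds w. f w' = h w'"
        by (rule eventually_mono) (simp add: h_def)
      with df [OF True] show ?thesis
        using DERIV_cong_ev by blast
    next
      case False
      then have "1 \<le> cmod w"
        using op_stableD_disc [OF st(2)] by force
      then have inv: "op_invertible (w *\<^sub>C id_blinfun - M)"
        by (rule op_stableD [OF st(1)])
      then have "\<forall>\<^sub>F w' in nhds w. op_invertible (w' *\<^sub>C id_blinfun - M)"
        using pencil_invertible_near [of "- M" w id_blinfun] unfolding pencilM
        by (auto elim: eventually_mono)
      then have "\<forall>\<^sub>F w' in nhds w. g w' = h w'"
        by (rule eventually_mono) (simp add: h_def fg)
      with dg [OF inv] show ?thesis
        using DERIV_cong_ev by blast
    qed
    then have "h holomorphic_on UNIV"
      by (auto simp: holomorphic_on_def field_differentiable_def)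
    moreover have "(h \<longlongrightarrow> 0) at_infinity"
    proof (rule Lim_transform_eventually)
      have "(g \<longlongrightarrow> cinner 0 y) at_infinity"
        unfolding g_def
        by (rule tendsto_cinner_left) (simp add: resolvent_tendsto_0)
      then show "(g \<longlongrightarrow> 0) at_infinity"
        by (simp add: cinner_zero_left)
      show "\<forall>\<^sub>F w in at_infinity. g w = h w"
        unfolding eventually_at_infinity h_def
        by (rule exI [of _ 1]) (auto simp: fg op_stableD [OF st(1)])
    qed
    ultimately have "h 0 = 0"
      by (rule Liouville_weak_0)
    moreover have "op_inv (id_blinfun :: 'p \<Rightarrow>\<^sub>L 'p) = id_blinfun"
      by (rule op_inv_eqI(2)) (simp_all add: compose_id_left)
    ultimately have "cinner (- E x) (E x) = 0"
      by (simp add: h_def f_def y_def scaleC_blinfun_zero op_invertible_id blinfun.minus_left)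
    then have "cinner (E x) (E x) = 0"
      using cinner_diff_left [of 0 "E x" "E x"] by (simp add: cinner_zero_left)
    then show ?thesis
      by (simp add: cinner_self)
  qed
  show ?thesis
    by (rule blinfun_eqI) (simp add: zero)
qed

section \<open>The two Riccati equations\<close>

text \<open>\<open>\<Delta>\<^sup>-\<^sup>1 (\<gamma>\<^sub>+ - \<gamma>\<^sub>- \<alpha>\<^sub>-\<^sup>-\<^sup>1 Q) = D\<^sup>-\<^sup>1 V\<close>: this lets the two Riccati equations, and the two
  expressions for \<open>\<alpha>\<^sub>+\<^sup>\<circ>\<close>, be exchanged for one another.\<close>

lemma Ricc1_gain_eq:
  assumes am: "op_invertible am" and Dl: "op_invertible (\<delta> - gm \<odot> op_inv am \<odot> bm)"
    and Q: "Q \<in> Ricc1 \<delta> ap bp gp am bm gm"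
  shows "op_inv (\<delta> - gm \<odot> op_inv am \<odot> bm) \<odot> (gp - gm \<odot> op_inv am \<odot> Q)
    = op_inv (\<delta> - gm \<odot> Q \<odot> bp) \<odot> (gp - gm \<odot> Q \<odot> ap)"
proof -
  define D where "D = \<delta> - gm \<odot> Q \<odot> bp"
  define V where "V = gp - gm \<odot> Q \<odot> ap"
  have D: "op_invertible D" and
    eq: "Q = am \<odot> Q \<odot> ap + (bm - am \<odot> Q \<odot> bp) \<odot> op_inv D \<odot> V"
    using Q by (auto simp: Ricc1_def D_def V_def)
  let ?Dl = "\<delta> - gm \<odot> op_inv am \<odot> bm"
  have "op_inv am \<odot> Q = Q \<odot> ap + (op_inv am \<odot> bm - Q \<odot> bp) \<odot> op_inv D \<odot> V"
    by (subst (1) eq) (simp add: compose_distribs compose_assoc op_inv_cancel [OF am])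
  then have "gp - gm \<odot> op_inv am \<odot> Q
      = V - (gm \<odot> op_inv am \<odot> bm - gm \<odot> Q \<odot> bp) \<odot> (op_inv D \<odot> V)"
    by (simp add: compose_distribs compose_assoc V_def)
  also have "gm \<odot> op_inv am \<odot> bm - gm \<odot> Q \<odot> bp = D - ?Dl"
    by (simp add: D_def)
  also have "V - (D - ?Dl) \<odot> (op_inv D \<odot> V) = ?Dl \<odot> (op_inv D \<odot> V)"
    by (simp only: compose_diff_left op_inv_cancel [OF D]) simp
  finally have "op_inv ?Dl \<odot> (gp - gm \<odot> op_inv am \<odot> Q) = op_inv D \<odot> V"
    using op_inv_cancel(1) [OF Dl] by simp
  then show ?thesis
    by (simp add: D_def V_def)
qed

lemma Ricc2'_gain_eq:
  assumes am: "op_invertible am" and Dl: "op_invertible (\<delta> - gm \<odot> op_inv am \<odot> bm)"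
    and Q: "Q \<in> Ricc2' \<delta> ap bp gp am bm gm"
  shows "op_inv (\<delta> - gm \<odot> op_inv am \<odot> bm) \<odot> (gp - gm \<odot> op_inv am \<odot> Q)
    = op_inv (\<delta> - gm \<odot> Q \<odot> bp) \<odot> (gp - gm \<odot> Q \<odot> ap)"
proof -
  define Dl' where "Dl' = \<delta> - gm \<odot> op_inv am \<odot> bm"
  define V where "V = gp - gm \<odot> op_inv am \<odot> Q"
  let ?D = "\<delta> - gm \<odot> Q \<odot> bp"
  have D: "op_invertible ?D" and
    eq: "Q = am \<odot> Q \<odot> ap + (bm - am \<odot> Q \<odot> bp) \<odot> op_inv Dl' \<odot> V"
    using Q by (auto simp: Ricc2'_def Dl'_def V_def)
  have Dl: "op_invertible Dl'"
    using Dl by (simp add: Dl'_def)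
  have "op_inv am \<odot> Q = Q \<odot> ap + (op_inv am \<odot> bm - Q \<odot> bp) \<odot> op_inv Dl' \<odot> V"
    by (subst (1) eq) (simp add: compose_distribs compose_assoc op_inv_cancel [OF am])
  then have "V = gp - gm \<odot> Q \<odot> ap
      - (gm \<odot> op_inv am \<odot> bm - gm \<odot> Q \<odot> bp) \<odot> (op_inv Dl' \<odot> V)"
    by (subst (1) V_def) (simp add: compose_distribs compose_assoc)
  also have "gm \<odot> op_inv am \<odot> bm - gm \<odot> Q \<odot> bp = ?D - Dl'"
    by (simp add: Dl'_def)
  finally have "gp - gm \<odot> Q \<odot> ap = V + (?D - Dl') \<odot> (op_inv Dl' \<odot> V)"
    by (simp add: algebra_simps)
  also have "\<dots> = ?D \<odot> (op_inv Dl' \<odot> V)"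
    by (simp only: compose_diff_left op_inv_cancel [OF Dl]) simp
  finally have "op_inv ?D \<odot> (gp - gm \<odot> Q \<odot> ap) = op_inv Dl' \<odot> V"
    using op_inv_cancel(1) [OF D] by simp
  then show ?thesis
    by (simp add: Dl'_def V_def)
qed

lemma Ricc1_eq_Ricc2':
  assumes "op_invertible am" "op_invertible (\<delta> - gm \<odot> op_inv am \<odot> bm)"
  shows "Ricc1 \<delta> ap bp gp am bm gm = Ricc2' \<delta> ap bp gp am bm gm"
proof (intro set_eqI iffI)
  fix Q
  assume Q: "Q \<in> Ricc1 \<delta> ap bp gp am bm gm"
  then show "Q \<in> Ricc2' \<delta> ap bp gp am bm gm"
    using Ricc1_gain_eq [OF assms Q] unfolding Ricc1_def Ricc2'_def
    by (simp add: compose_assoc)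
next
  fix Q
  assume Q: "Q \<in> Ricc2' \<delta> ap bp gp am bm gm"
  then show "Q \<in> Ricc1 \<delta> ap bp gp am bm gm"
    using Ricc2'_gain_eq [OF assms Q] unfolding Ricc1_def Ricc2'_def
    by (simp add: compose_assoc)
qed

lemma alpha_plus_circ_eq:
  assumes "op_invertible am" "op_invertible (\<delta> - gm \<odot> op_inv am \<odot> bm)"
    and "Q \<in> Ricc1 \<delta> ap bp gp am bm gm"
  shows "alpha_plus_circ \<delta> ap bp gp gm Q
    = ap - bp \<odot> op_inv (\<delta> - gm \<odot> op_inv am \<odot> bm) \<odot> (gp - gm \<odot> op_inv am \<odot> Q)"
  using Ricc1_gain_eq [OF assms] by (simp add: alpha_plus_circ_def compose_assoc)

text \<open>The Woodbury formula. It applies to \<open>\<alpha>\<^sub>-\<^sup>\<circ>\<close> with \<open>D = \<delta> - \<gamma>\<^sub>- Q \<beta>\<^sub>+\<close> and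
  \<open>W = \<beta>\<^sub>- - \<alpha>\<^sub>- Q \<beta>\<^sub>+\<close>, because
  \<open>\<delta> - \<gamma>\<^sub>- \<alpha>\<^sub>-\<^sup>-\<^sup>1 \<beta>\<^sub>- = (\<delta> - \<gamma>\<^sub>- Q \<beta>\<^sub>+) - \<gamma>\<^sub>- \<alpha>\<^sub>-\<^sup>-\<^sup>1 (\<beta>\<^sub>- - \<alpha>\<^sub>- Q \<beta>\<^sub>+)\<close>.\<close>

lemma woodbury:
  assumes a: "op_invertible a" and D: "op_invertible D"
    and S: "op_invertible (D - g \<odot> op_inv a \<odot> W)"
  shows "op_invertible (a - W \<odot> op_inv D \<odot> g)"
    and "op_inv (a - W \<odot> op_inv D \<odot> g)
      = op_inv a + op_inv a \<odot> W \<odot> op_inv (D - g \<odot> op_inv a \<odot> W) \<odot> g \<odot> op_inv a"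
proof -
  define S where "S = D - g \<odot> op_inv a \<odot> W"
  have S': "op_invertible S"
    using S by (simp add: S_def)
  have gaW: "g \<odot> (op_inv a \<odot> W) = D - S"
    by (simp add: S_def compose_assoc)
  have gaW': "g \<odot> (op_inv a \<odot> (W \<odot> X)) = D \<odot> X - S \<odot> X" for X :: "'z::real_normed_vector \<Rightarrow>\<^sub>L _"
    by (simp add: gaW [symmetric] compose_diff_left [symmetric] compose_assoc)
  let ?T = "a - W \<odot> op_inv D \<odot> g"
    and ?X = "op_inv a + op_inv a \<odot> W \<odot> op_inv S \<odot> g \<odot> op_inv a"
  have "?X \<odot> ?T = id_blinfun" "?T \<odot> ?X = id_blinfun"
    by (simp_all add: compose_distribs compose_assoc op_inv_cancel a D S' op_inv compose_id_right
        gaW')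
  from op_inv_eqI [OF this]
  show "op_invertible ?T"
    "op_inv ?T = op_inv a + op_inv a \<odot> W \<odot> op_inv (D - g \<odot> op_inv a \<odot> W) \<odot> g \<odot> op_inv a"
    by (simp_all add: S_def)
qed

lemma stabilizing_iff:
  assumes cop: "complex_op \<delta>" "complex_op bp" "complex_op am" "complex_op bm" "complex_op gm"
    and am: "op_invertible am" and Dl: "op_invertible (\<delta> - gm \<odot> op_inv am \<odot> bm)"
    and Q: "Q \<in> Ricc1 \<delta> ap bp gp am bm gm"
  shows "stabilizing1 \<delta> ap bp gp am bm gm Q \<longleftrightarrow> stabilizing2 \<delta> ap bp gp am bm gm Q"
proof -
  define D where "D = \<delta> - gm \<odot> Q \<odot> bp"
  define W where "W = bm - am \<odot> Q \<odot> bp"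
  have D: "op_invertible D" and "complex_op Q"
    using Q by (auto simp: Ricc1_def D_def)
  have Dl_eq: "\<delta> - gm \<odot> op_inv am \<odot> bm = D - gm \<odot> op_inv am \<odot> W"
    by (simp add: D_def W_def compose_distribs compose_assoc op_inv_cancel [OF am])
  have minus: "alpha_minus_circ \<delta> bp am bm gm Q = am - W \<odot> op_inv D \<odot> gm"
    by (simp add: alpha_minus_circ_def D_def W_def)
  have "complex_op (alpha_minus_circ \<delta> bp am bm gm Q)"
    unfolding alpha_minus_circ_def using cop \<open>complex_op Q\<close> D
    by (intro complex_op_diff complex_op_compose complex_op_op_inv) (auto simp: D_def)
  then have "op_stable (alpha_minus_circ \<delta> bp am bm gm Q) \<longleftrightarrow>
      op_antistable (op_inv (am - W \<odot> op_inv D \<odot> gm))"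
    unfolding minus using op_antistable_op_inv_iff woodbury(1) am D Dl Dl_eq by metis
  also have "op_inv (am - W \<odot> op_inv D \<odot> gm) = op_inv am + op_inv am \<odot> W
      \<odot> op_inv (\<delta> - gm \<odot> op_inv am \<odot> bm) \<odot> gm \<odot> op_inv am"
    unfolding Dl_eq by (rule woodbury(2)) (use am D Dl Dl_eq in auto)
  finally show ?thesis
    unfolding stabilizing1_def stabilizing2_def alpha_plus_circ_eq [OF am Dl Q] W_def by simp
qed

text \<open>Two solutions use different closed-loop operators: \<open>\<alpha>\<^sub>-\<^sup>\<circ>\<close> belongs to \<open>Q\<close>, \<open>\<alpha>\<^sub>+\<^sup>\<circ>\<close> to \<open>Q'\<close>.\<close>

lemma Ricc1_diff_eq:
  assumes Q: "Q \<in> Ricc1 \<delta> ap bp gp am bm gm" and Q': "Q' \<in> Ricc1 \<delta> ap bp gp am bm gm"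
  shows "Q - Q' = alpha_minus_circ \<delta> bp am bm gm Q \<odot> (Q - Q') \<odot> alpha_plus_circ \<delta> ap bp gp gm Q'"
proof -
  define D D' where "D = \<delta> - gm \<odot> Q \<odot> bp" and "D' = \<delta> - gm \<odot> Q' \<odot> bp"
  define V V' where "V = gp - gm \<odot> Q \<odot> ap" and "V' = gp - gm \<odot> Q' \<odot> ap"
  define W W' where "W = bm - am \<odot> Q \<odot> bp" and "W' = bm - am \<odot> Q' \<odot> bp"
  define E where "E = Q - Q'"
  have D: "op_invertible D" and eq: "Q = am \<odot> Q \<odot> ap + W \<odot> op_inv D \<odot> V"
    using Q by (auto simp: Ricc1_def D_def V_def W_def)
  have D': "op_invertible D'" and eq': "Q' = am \<odot> Q' \<odot> ap + W' \<odot> op_inv D' \<odot> V'"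
    using Q' by (auto simp: Ricc1_def D'_def V'_def W'_def)
  have aE: "am \<odot> E \<odot> bp = W' - W" and gEb: "gm \<odot> E \<odot> bp = D' - D" and gEa: "gm \<odot> E \<odot> ap = V' - V"
    by (simp_all add: E_def W_def W'_def D_def D'_def V_def V'_def compose_distribs)
  have "alpha_minus_circ \<delta> bp am bm gm Q \<odot> E \<odot> alpha_plus_circ \<delta> ap bp gp gm Q'
      = (am - W \<odot> op_inv D \<odot> gm) \<odot> E \<odot> (ap - bp \<odot> op_inv D' \<odot> V')"
    by (simp add: alpha_minus_circ_def alpha_plus_circ_def D_def D'_def V'_def W_def)
  also have "\<dots> = am \<odot> E \<odot> ap - (am \<odot> E \<odot> bp) \<odot> op_inv D' \<odot> V'
      - W \<odot> op_inv D \<odot> (gm \<odot> E \<odot> ap) + W \<odot> op_inv D \<odot> (gm \<odot> E \<odot> bp) \<odot> op_inv D' \<odot> V'"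
    by (simp add: compose_distribs compose_assoc)
  also have "\<dots> = am \<odot> E \<odot> ap + W \<odot> op_inv D \<odot> V - W' \<odot> op_inv D' \<odot> V'"
    unfolding aE gEb gEa
    by (simp add: compose_distribs compose_assoc op_inv_cancel D D')
  also have "\<dots> = E"
    using eq eq' by (simp add: E_def compose_distribs algebra_simps)
  finally show ?thesis
    by (simp add: E_def)
qed

lemma stabilizing1_unique:
  assumes cop: "complex_op \<delta>" "complex_op ap" "complex_op bp" "complex_op gp"
      "complex_op am" "complex_op bm" "complex_op gm"
    and Q: "Q \<in> Ricc1 \<delta> ap bp gp am bm gm" "stabilizing1 \<delta> ap bp gp am bm gm Q"
    and Q': "Q' \<in> Ricc1 \<delta> ap bp gp am bm gm" "stabilizing1 \<delta> ap bp gp am bm gm Q'"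
  shows "Q = Q'"
proof -
  have "complex_op Q" "op_invertible (\<delta> - gm \<odot> Q \<odot> bp)"
    "complex_op Q'" "op_invertible (\<delta> - gm \<odot> Q' \<odot> bp)"
    using Q Q' by (auto simp: Ricc1_def)
  note ops = this cop
  have "Q - Q' = 0"
  proof (rule stein_equation_stable_eq_0)
    show "Q - Q' = alpha_minus_circ \<delta> bp am bm gm Q \<odot> (Q - Q') \<odot> alpha_plus_circ \<delta> ap bp gp gm Q'"
      using Q Q' by (intro Ricc1_diff_eq)
    show "complex_op (alpha_minus_circ \<delta> bp am bm gm Q)"
      "complex_op (alpha_plus_circ \<delta> ap bp gp gm Q')" "complex_op (Q - Q')"
      unfolding alpha_minus_circ_def alpha_plus_circ_def
      by (intro complex_op_diff complex_op_compose complex_op_op_inv ops)+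
  qed (use Q Q' in \<open>auto simp: stabilizing1_def\<close>)
  then show ?thesis
    by simp
qed

theorem corollary3p8:
  fixes R :: "complex \<Rightarrow> 'u::complex_hilbert \<Rightarrow>\<^sub>L 'u"
    and \<delta> :: "'u \<Rightarrow>\<^sub>L 'u"
    and ap :: "'p::complex_hilbert \<Rightarrow>\<^sub>L 'p" and bp :: "'u \<Rightarrow>\<^sub>L 'p" and gp :: "'p \<Rightarrow>\<^sub>L 'u"
    and am :: "'m::complex_hilbert \<Rightarrow>\<^sub>L 'm" and bm :: "'u \<Rightarrow>\<^sub>L 'm" and gm :: "'m \<Rightarrow>\<^sub>L 'u"
  assumes "stable_representation R \<delta> ap bp gp am bm gm"
    and "op_invertible am"
    and "op_invertible (R 0)"
  shows "(\<forall>Q \<in> Ricc1 \<delta> ap bp gp am bm gm.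
            alpha_plus_circ \<delta> ap bp gp gm Q =
              ap - bp \<odot> op_inv (\<delta> - gm \<odot> op_inv am \<odot> bm) \<odot> (gp - gm \<odot> op_inv am \<odot> Q)) \<and>
         (\<forall>Q. Q \<in> Ricc1 \<delta> ap bp gp am bm gm \<and> stabilizing1 \<delta> ap bp gp am bm gm Q \<longleftrightarrow>
              Q \<in> Ricc2' \<delta> ap bp gp am bm gm \<and> stabilizing2 \<delta> ap bp gp am bm gm Q) \<and>
         (\<forall>Q Q'. Q \<in> Ricc1 \<delta> ap bp gp am bm gm \<and> stabilizing1 \<delta> ap bp gp am bm gm Q \<and>
              Q' \<in> Ricc1 \<delta> ap bp gp am bm gm \<and> stabilizing1 \<delta> ap bp gp am bm gm Q' \<longrightarrow> Q = Q')"
proof -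
  have Dl: "op_invertible (\<delta> - gm \<odot> op_inv am \<odot> bm)"
    using stable_representation_at_0 [OF assms(1,2)] assms(3) by simp
  have cop: "complex_op \<delta>" "complex_op ap" "complex_op bp" "complex_op gp"
    "complex_op am" "complex_op bm" "complex_op gm"
    using assms(1) by (auto simp: stable_representation_def)
  show ?thesis
    using alpha_plus_circ_eq [OF assms(2) Dl] Ricc1_eq_Ricc2' [OF assms(2) Dl]
      stabilizing_iff [OF cop(1,3,5-7) assms(2) Dl] stabilizing1_unique [OF cop]
    by blast
qed

end
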